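(* Let $0<\alpha\le 1$, let $I\subseteq \mathbb{R}$ be an interval with interior $I^0$, and let $f: I^0\to \mathbb{R}^\alpha$ be such that $f\in D_\alpha(I^0)$ and $f^{(\alpha)}\in C_\alpha[a,b]$, where $a,b\in I^0$ with $a<b$. Then $$\frac{f(a)+f(b)}{2^\alpha}-\frac{\Gamma(1+\alpha)}{(b-a)^\alpha}\,{}_aI_b^{(\alpha)}f(x)=\frac{(b-a)^\alpha}{2^\alpha}\,\frac{1}{\Gamma(1+\alpha)}\int_0^1(1-2t)^\alpha f^{(\alpha)}(ta+(1-t)b)\,(dt)^\alpha .$$
   Context: Conventions of local fractional calculus (Gao–Yang–Kang), for fixed $0<\alpha\le1$. The set $\mathbb{R}^\alpha$ of ($\alpha$-type) real line numbers is $\mathbb{R}^\alpha=\mathbb{Q}^\alpha\cup\mathbb{J}^\alpha$, where $\mathbb{Q}^\alpha=\{m^\alpha=(p/q)^\alpha: p,q\in\mathbb{Z}, q\ne0\}$ and $\mathbb{J}^\alpha=\{m^\alpha\neq(p/q)^\alpha: p,q\in\mathbb{Z},q\neq0\}$. That is, its elements are the symbols $x^\alpha$ with $x$ real (including negative $x$). The operations satisfy $a^\alpha+b^\alpha=(a+b)^\alpha=b^\alpha+a^\alpha$ and $a^\alpha b^\alpha=(ab)^\alpha=b^\alpha a^\alpha$, are associative and distributive, and have neutral elements $0^\alpha$ and $1^\alpha$. Expressions such as $(1-2t)^\alpha$, $(b-a)^\alpha$, $2^\alpha$ denote elements of $\mathbb{R}^\alpha$ in this sense. Local fractional continuity: $f:\mathbb{R}\to\mathbb{R}^\alpha$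 is local fractional continuous at $x_0$ if for every $\varepsilon>0$ there is $\delta>0$ such that $|f(x)-f(x_0)|<\varepsilon^\alpha$ whenever $|x-x_0|<\delta$. $C_\alpha$ of an interval denotes the functions that are local fractional continuous on that interval. Local fractional derivative of order $\alpha$ at $x_0$: $f^{(\alpha)}(x_0)=\lim_{x\to x_0}\frac{\Delta^\alpha(f(x)-f(x_0))}{(x-x_0)^\alpha}$, where $\Delta^\alpha(f(x)-f(x_0))\cong\Gamma(1+\alpha)(f(x)-f(x_0))$. $f\in D_\alpha(I^0)$ means that $f^{(\alpha)}(x)$ exists for every $x\in I^0$. Local fractional integral of $f\in C_\alpha[a,b]$: ${}_aI_b^{(\alpha)}f(x)=\frac{1}{\Gamma(1+\alpha)}\int_a^b f(t)(dt)^\alpha=\frac{1}{\Gamma(1+\alpha)}\lim_{\Delta t\to0}\sum_{j=0}^{N-1}f(t_j)(\Delta t_j)^\alpha$, where $a=t_0<t_1<\cdots<t_N=b$ is a partition of $[a,b]$, $\Delta t_j=t_{j+1}-t_j$ and $\Delta t=\max_j\Delta t_j$. Here $\Gamma$ is Euler's Gamma function. *)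

theory Defs
  imports "HOL-Analysis.Analysis"
begin

text \<open>
  The real line numbers of type \<open>\<alpha>\<close> are the symbols \<open>x\<^sup>\<alpha>\<close> with \<open>x\<close> an arbitrary real. Since
  \<open>a\<^sup>\<alpha> + b\<^sup>\<alpha> = (a + b)\<^sup>\<alpha>\<close> is false for ordinary powers, they form a type of their own, whose
  elements \<open>fpow x\<close> stand for \<open>x\<^sup>\<alpha>\<close>; the operations are those prescribed on symbols. The exponent
  \<open>\<alpha>\<close> is fixed throughout, so it is not an argument of \<open>fpow\<close>.
\<close>

typedef areal = "UNIV :: real set"
  morphisms base fpow
  by simp

setup_lifting type_definition_areal

instantiation areal :: linordered_field
begin

lift_definition zero_areal :: areal is 0 .
lift_definition one_areal :: areal is 1 .
lift_definition plus_areal :: "areal \<Rightarrow> areal \<Rightarrow> areal" is "(+)" .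
lift_definition minus_areal :: "areal \<Rightarrow> areal \<Rightarrow> areal" is "(-)" .
lift_definition uminus_areal :: "areal \<Rightarrow> areal" is uminus .
lift_definition times_areal :: "areal \<Rightarrow> areal \<Rightarrow> areal" is "(*)" .
lift_definition inverse_areal :: "areal \<Rightarrow> areal" is inverse .
lift_definition divide_areal :: "areal \<Rightarrow> areal \<Rightarrow> areal" is "(/)" .
lift_definition less_eq_areal :: "areal \<Rightarrow> areal \<Rightarrow> bool" is "(\<le>)" .
lift_definition less_areal :: "areal \<Rightarrow> areal \<Rightarrow> bool" is "(<)" .
lift_definition abs_areal :: "areal \<Rightarrow> areal" is abs .
lift_definition sgn_areal :: "areal \<Rightarrow> areal" is sgn .

instance
  by (standard; transfer)
    (auto simp: algebra_simps divide_inverse sgn_if abs_if mult_strict_left_mono)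

end

instantiation areal :: linorder_topology
begin

definition open_areal :: "areal set \<Rightarrow> bool" where
  "open_areal = generate_topology (range (\<lambda>a. {..<a}) \<union> range (\<lambda>a. {a<..}))"

instance
  by standard (rule open_areal_def)

end

lemma fpow_add: "fpow a + fpow b = fpow (a + b)"
  and fpow_diff: "fpow a - fpow b = fpow (a - b)"
  and fpow_mult: "fpow a * fpow b = fpow (a * b)"
  and fpow_divide: "fpow a / fpow b = fpow (a / b)"
  and fpow_0: "fpow 0 = 0"
  and fpow_1: "fpow 1 = 1"
  and fpow_abs: "\<bar>fpow a\<bar> = fpow \<bar>a\<bar>"
  and fpow_less_iff: "fpow a < fpow b \<longleftrightarrow> a < b"
  by (transfer; simp)+

text \<open>
  An ordinary real factor such as \<open>\<Gamma>(1 + \<alpha>)\<close> is read as the symbol \<open>x\<^sup>\<alpha>\<close> whose value as an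
  ordinary power is that real: \<open>c = (c\<^bsup>1/\<alpha>\<^esup>)\<^sup>\<alpha>\<close> for \<open>c > 0\<close>, extended oddly to all \<open>c\<close>. It is thus
  different from \<open>c\<^sup>\<alpha>\<close>, i.e. \<open>fpow c\<close>. This embedding preserves products and order but, for
  \<open>\<alpha> \<noteq> 1\<close>, not sums.
\<close>

definition of_number :: "real \<Rightarrow> real \<Rightarrow> areal" where
  "of_number \<alpha> c = fpow (sgn c * \<bar>c\<bar> powr (1 / \<alpha>))"

lemma of_number_powr: "\<alpha> \<noteq> 0 \<Longrightarrow> 0 < x \<Longrightarrow> of_number \<alpha> (x powr \<alpha>) = fpow x"
  by (simp add: of_number_def powr_powr)

lemma of_number_mult: "of_number \<alpha> (c * d) = of_number \<alpha> c * of_number \<alpha> d"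
  by (simp add: of_number_def fpow_mult sgn_mult abs_mult powr_mult mult_ac)

text \<open>At the endpoints of an interval, continuity is understood relative to the interval.\<close>

definition lf_C :: "real set \<Rightarrow> (real \<Rightarrow> areal) set" where
  "lf_C S = {f. \<forall>x0\<in>S. \<forall>\<epsilon>>0. \<exists>\<delta>>0. \<forall>x\<in>S. \<bar>x - x0\<bar> < \<delta> \<longrightarrow> \<bar>f x - f x0\<bar> < fpow \<epsilon>}"

definition has_lf_deriv :: "real \<Rightarrow> (real \<Rightarrow> areal) \<Rightarrow> areal \<Rightarrow> real \<Rightarrow> bool" where
  "has_lf_deriv \<alpha> f D x0 \<longleftrightarrow>
     ((\<lambda>x. of_number \<alpha> (Gamma (1 + \<alpha>)) * (f x - f x0) / fpow (x - x0)) \<longlongrightarrow> D) (at x0)"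

definition lf_deriv :: "real \<Rightarrow> (real \<Rightarrow> areal) \<Rightarrow> real \<Rightarrow> areal" where
  "lf_deriv \<alpha> f x0 = (THE D. has_lf_deriv \<alpha> f D x0)"

definition lf_D :: "real \<Rightarrow> real set \<Rightarrow> (real \<Rightarrow> areal) set" where
  "lf_D \<alpha> S = {f. \<forall>x\<in>S. \<exists>D. has_lf_deriv \<alpha> f D x}"

text \<open>A partition is a pair \<open>(N, t)\<close> of which only \<open>t 0, \<dots>, t N\<close> matter.\<close>

definition partitions :: "real \<Rightarrow> real \<Rightarrow> (nat \<times> (nat \<Rightarrow> real)) set" where
  "partitions a b = {(N, t). 0 < N \<and> t 0 = a \<and> t N = b \<and> (\<forall>j<N. t j < t (Suc j))}"

definition mesh :: "nat \<times> (nat \<Rightarrow> real) \<Rightarrow> real" where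
  "mesh = (\<lambda>(N, t). Max ((\<lambda>j. t (Suc j) - t j) ` {..<N}))"

text \<open>The filter of \<open>\<Delta>t \<longrightarrow> 0\<close>, over all partitions of \<open>[a, b]\<close>.\<close>

definition mesh_to_0 :: "real \<Rightarrow> real \<Rightarrow> (nat \<times> (nat \<Rightarrow> real)) filter" where
  "mesh_to_0 a b = (INF \<delta>\<in>{0<..}. principal {p \<in> partitions a b. mesh p < \<delta>})"

definition lf_sum :: "(real \<Rightarrow> areal) \<Rightarrow> nat \<times> (nat \<Rightarrow> real) \<Rightarrow> areal" where
  "lf_sum f = (\<lambda>(N, t). \<Sum>j<N. f (t j) * fpow (t (Suc j) - t j))"

text \<open>\<open>lf_int a b f\<close> is \<open>\<integral>\<^sub>a\<^sup>b f(t) (dt)\<^sup>\<alpha>\<close>, without the factor \<open>1 / \<Gamma>(1 + \<alpha>)\<close>.\<close>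

definition lf_int :: "real \<Rightarrow> real \<Rightarrow> (real \<Rightarrow> areal) \<Rightarrow> areal" where
  "lf_int a b f = Lim (mesh_to_0 a b) (lf_sum f)"

definition lf_I :: "real \<Rightarrow> real \<Rightarrow> real \<Rightarrow> (real \<Rightarrow> areal) \<Rightarrow> areal" where
  "lf_I \<alpha> a b f = 1 / of_number \<alpha> (Gamma (1 + \<alpha>)) * lf_int a b f"

end

theory Submission imports Defs begin

text \<open>
  Since the operations and the order of the symbols \<open>x\<^sup>\<alpha>\<close> are those of their bases \<open>x\<close>, passing to
  bases turns the identity into one of ordinary calculus. Write \<open>F\<close> for the base of \<open>f\<close> and
  \<open>G > 0\<close> for the base of the number \<open>\<Gamma>(1 + \<alpha>)\<close>. Then the local fractional derivative of \<open>f\<close> has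
  base \<open>G F'\<close> (\<open>has_lf_deriv_iff_base\<close>), local fractional continuity is continuity of the base, and
  for a continuous integrand, \<open>\<integral>\<^sub>a\<^sup>b f(t) (dt)\<^sup>\<alpha>\<close>, taken without its factor \<open>1 / \<Gamma>(1 + \<alpha>)\<close>, has as base
  the integral of the base (\<open>lf_int_eq_integral\<close>), because the sums approximating it have as bases
  the Riemann sums of the base. On the
  left, the two factors involving \<open>\<Gamma>(1 + \<alpha>)\<close> cancel each other; on the right, the factor
  \<open>1 / G\<close> cancels the \<open>G\<close> in the derivative. The exponent \<open>\<alpha>\<close> has now disappeared, and what
  remains is
  \<open>(F a + F b) / 2 - (\<integral>\<^sub>a\<^sup>b F) / (b - a) = (b - a) / 2 * \<integral>\<^sub>0\<^sup>1 (1 - 2 t) F' (t a + (1 - t) b) dt\<close>,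
  the classical error term of the trapezoidal rule, which is an integration by parts
  (\<open>trapezoid_error_identity\<close>).
\<close>

section \<open>Order, limits and derivatives of bases\<close>

lemma base_fpow [simp]: "base (fpow x) = x"
  by (simp add: fpow_inverse)

lemmas base_simps = plus_areal.rep_eq minus_areal.rep_eq times_areal.rep_eq divide_areal.rep_eq
  one_areal.rep_eq zero_areal.rep_eq abs_areal.rep_eq

lemma less_areal_iff_base: "x < y \<longleftrightarrow> base x < base y"
  by transfer simp

lemma base_sum: "base (\<Sum>x\<in>A. g x) = (\<Sum>x\<in>A. base (g x))"
  by (induction A rule: infinite_finite_induct) (simp_all add: base_simps)

text \<open>
  The topology is the order topology on both sides, and the order is that of the bases, so
  convergence can be tested on the open rays.
\<close>

lemma tendsto_areal_iff_base:
  "(g \<longlongrightarrow> l) F \<longleftrightarrow> ((\<lambda>x. base (g x)) \<longlongrightarrow> base l) F"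
proof -
  have "(\<forall>u. P u) \<longleftrightarrow> (\<forall>r. P (fpow r))" for P
    by (metis base_inverse)
  then show ?thesis
    by (simp add: order_tendsto_iff less_areal_iff_base)
qed

lemma lf_C_iff_continuous_on_base: "g \<in> lf_C S \<longleftrightarrow> continuous_on S (\<lambda>x. base (g x))"
  by (simp add: lf_C_def continuous_on_iff less_areal_iff_base base_simps dist_real_def)

lemma base_of_number_pos: "0 < c \<Longrightarrow> 0 < base (of_number \<alpha> c)"
  by (simp add: of_number_def)

text \<open>
  The quotient defining the derivative has base \<open>G\<close> times the ordinary difference quotient, and
  \<open>G\<close> can be divided out because the Gamma function does not vanish at \<open>1 + \<alpha>\<close>.
\<close>

lemma has_lf_deriv_iff_base:
  assumes "0 < \<alpha>"
  defines "G \<equiv> base (of_number \<alpha> (Gamma (1 + \<alpha>)))"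
  shows "has_lf_deriv \<alpha> f D x \<longleftrightarrow>
    ((\<lambda>x. base (f x)) has_real_derivative base D / G) (at x)"
proof -
  have "G \<noteq> 0"
    using base_of_number_pos[of "Gamma (1 + \<alpha>)" \<alpha>] assms by (simp add: Gamma_real_pos)
  let ?q = "\<lambda>y. (base (f y) - base (f x)) / (y - x)"
  have "has_lf_deriv \<alpha> f D x \<longleftrightarrow> ((\<lambda>y. G * ?q y) \<longlongrightarrow> G * (base D / G)) (at x)"
    using \<open>G \<noteq> 0\<close> by (simp add: has_lf_deriv_def tendsto_areal_iff_base base_simps G_def)
  also have "\<dots> \<longleftrightarrow> (?q \<longlongrightarrow> base D / G) (at x)"
    using \<open>G \<noteq> 0\<close> by (intro tendsto_mult_left_iff)
  finally show ?thesis
    by (simp add: has_field_derivative_iff)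
qed

lemma has_lf_deriv_lf_deriv:
  assumes "has_lf_deriv \<alpha> f D x"
  shows "has_lf_deriv \<alpha> f (lf_deriv \<alpha> f x) x"
  unfolding lf_deriv_def
proof (rule theI)
  show "has_lf_deriv \<alpha> f D x" by fact
  show "D' = D" if "has_lf_deriv \<alpha> f D' x" for D'
    using that assms unfolding has_lf_deriv_def by (intro tendsto_unique[OF trivial_limit_at])
qed

section \<open>The local fractional integral as a Riemann integral\<close>

lemma eventually_mesh_to_0:
  "eventually P (mesh_to_0 a b) \<longleftrightarrow> (\<exists>\<delta>>0. \<forall>p\<in>partitions a b. mesh p < \<delta> \<longrightarrow> P p)"
proof -
  have "eventually P (mesh_to_0 a b) \<longleftrightarrow>
    (\<exists>\<delta>\<in>{0<..}. eventually P (principal {p \<in> partitions a b. mesh p < \<delta>}))"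
    unfolding mesh_to_0_def
  proof (rule eventually_INF_base)
    show "\<exists>\<delta>\<in>{0<..}. principal {p \<in> partitions a b. mesh p < \<delta>}
        \<le> inf (principal {p \<in> partitions a b. mesh p < \<delta>1})
            (principal {p \<in> partitions a b. mesh p < \<delta>2})"
      if "\<delta>1 \<in> {0<..}" "\<delta>2 \<in> {0<..}" for \<delta>1 \<delta>2 :: real
      using that by (intro bexI[of _ "min \<delta>1 \<delta>2"]) auto
  qed auto
  then show ?thesis
    by (auto simp: eventually_principal)
qed

lemma mesh_less_iff:
  "0 < N \<Longrightarrow> mesh (N, t) < \<delta> \<longleftrightarrow> (\<forall>j<N. t (Suc j) - t j < \<delta>)"
  by (auto simp: mesh_def lessThan_empty_iff)

text \<open>
  Equidistant partitions can be made arbitrarily fine. Without this, limits of the sums would not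
  be unique, and the integral, which is chosen as such a limit, would not be determined by them.
\<close>

lemma mesh_to_0_neq_bot:
  assumes "a < b"
  shows "mesh_to_0 a b \<noteq> bot"
proof -
  have "\<exists>p\<in>partitions a b. mesh p < \<delta>" if "0 < \<delta>" for \<delta>
  proof -
    obtain n where n: "(b - a) / \<delta> < real n"
      using reals_Archimedean2 by blast
    moreover have "0 < (b - a) / \<delta>"
      using assms that by simp
    ultimately have "0 < n"
      using of_nat_0_less_iff less_trans by blast
    \<comment> \<open>equidistant points; the condition on \<open>n\<close> says that their distance is below \<open>\<delta>\<close>\<close>
    define t where "t j = a + real j * ((b - a) / n)" for j
    have diff: "t (Suc j) - t j = (b - a) / n" for j
      by (simp add: t_def distrib_right add_divide_distrib)
    have "t j < t (Suc j)" for j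
      using diff[of j] \<open>0 < n\<close> assms by (smt (verit) divide_pos_pos of_nat_0_less_iff)
    moreover have "t 0 = a" "t n = b"
      using \<open>0 < n\<close> by (simp_all add: t_def)
    ultimately have "(n, t) \<in> partitions a b"
      using \<open>0 < n\<close> by (simp add: partitions_def)
    moreover have "mesh (n, t) < \<delta>"
      using n \<open>0 < n\<close> that by (simp add: mesh_less_iff diff field_simps)
    ultimately show ?thesis by blast
  qed
  then show ?thesis
    by (auto simp: trivial_limit_def eventually_mesh_to_0)
qed

lemma partition_mono:
  assumes "(N, t) \<in> partitions a b" "i \<le> j" "j \<le> N"
  shows "t i \<le> t j"
  using assms(2,3)
proof (induction j rule: dec_induct)
  case (step j)
  then have "t j < t (Suc j)"
    using assms(1) by (auto simp: partitions_def)
  with step show ?case by simp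
qed simp

lemma integral_partition:
  fixes g :: "real \<Rightarrow> real"
  assumes p: "(N, t) \<in> partitions a b" and g: "g integrable_on {a..b}"
  shows "integral {a..b} g = (\<Sum>j<N. integral {t j..t (Suc j)} g)"
proof -
  have t: "t 0 = a" "t N = b"
    using p by (auto simp: partitions_def)
  have "n \<le> N \<Longrightarrow> integral {a..t n} g = (\<Sum>j<n. integral {t j..t (Suc j)} g)" for n
  proof (induction n)
    case 0
    then show ?case using t by simp
  next
    case (Suc n)
    have le: "a \<le> t n" "t n \<le> t (Suc n)" "t (Suc n) \<le> b"
      using partition_mono[OF p, of 0 n] partition_mono[OF p, of n "Suc n"]
        partition_mono[OF p, of "Suc n" N] Suc.prems t by auto
    then have "g integrable_on {a..t (Suc n)}"
      using g by (rule_tac integrable_on_subinterval[of g "{a..b}"]) auto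
    then have "integral {a..t (Suc n)} g = integral {a..t n} g + integral {t n..t (Suc n)} g"
      using le by (simp add: Henstock_Kurzweil_Integration.integral_combine)
    with Suc show ?case by simp
  qed
  from this[of N] t show ?thesis by simp
qed

text \<open>
  On each piece of the partition, \<open>g\<close> deviates by at most \<open>e\<close> from its value at the left endpoint,
  so the piece contributes to the error at most \<open>e\<close> times its length.
\<close>

lemma riemann_sum_error:
  fixes g :: "real \<Rightarrow> real"
  assumes p: "(N, t) \<in> partitions a b" and mesh: "mesh (N, t) < \<delta>" and g: "continuous_on {a..b} g"
    and \<delta>: "\<And>x y. x \<in> {a..b} \<Longrightarrow> y \<in> {a..b} \<Longrightarrow> \<bar>y - x\<bar> < \<delta> \<Longrightarrow> \<bar>g y - g x\<bar> \<le> e"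
  shows "\<bar>(\<Sum>j<N. g (t j) * (t (Suc j) - t j)) - integral {a..b} g\<bar> \<le> e * (b - a)"
proof -
  have t: "t 0 = a" "t N = b" "0 < N"
    using p by (auto simp: partitions_def)
  have step: "\<bar>g (t j) * (t (Suc j) - t j) - integral {t j..t (Suc j)} g\<bar> \<le> e * (t (Suc j) - t j)"
    if "j < N" for j
  proof -
    have le: "a \<le> t j" "t j \<le> t (Suc j)" "t (Suc j) \<le> b"
      using partition_mono[OF p, of 0 j] partition_mono[OF p, of j "Suc j"]
        partition_mono[OF p, of "Suc j" N] that t by auto
    have lt: "t (Suc j) - t j < \<delta>"
      using mesh that t by (simp add: mesh_less_iff)
    have c: "continuous_on {t j..t (Suc j)} g"
      using g by (rule continuous_on_subset) (use le in auto)
    have "integral {t j..t (Suc j)} (\<lambda>x. g x - g (t j))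
      = integral {t j..t (Suc j)} g - g (t j) * (t (Suc j) - t j)"
      using c le by (subst integral_diff) (auto intro: integrable_continuous_interval)
    moreover have "norm (integral {t j..t (Suc j)} (\<lambda>x. g x - g (t j))) \<le> e * (t (Suc j) - t j)"
      using le lt c by (intro integral_bound continuous_intros) (auto intro!: \<delta>)
    ultimately show ?thesis by simp
  qed
  have "\<bar>(\<Sum>j<N. g (t j) * (t (Suc j) - t j)) - integral {a..b} g\<bar>
    = \<bar>\<Sum>j<N. g (t j) * (t (Suc j) - t j) - integral {t j..t (Suc j)} g\<bar>"
    using integral_partition[OF p integrable_continuous_interval[OF g]] by (simp add: sum_subtractf)
  also have "\<dots> \<le> (\<Sum>j<N. e * (t (Suc j) - t j))"
    using step by (intro order_trans[OF sum_abs] sum_mono) auto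
  also have "\<dots> = e * (b - a)"
    using t by (simp add: sum_lessThan_telescope flip: sum_distrib_left)
  finally show ?thesis .
qed

text \<open>
  Continuity on a compact interval is uniform, so one bound on the mesh makes \<open>riemann_sum_error\<close>
  apply to all pieces of a partition at once.
\<close>

lemma lf_int_eq_integral:
  assumes "a < b" and g: "continuous_on {a..b} (\<lambda>x. base (g x))"
  shows "lf_int a b g = fpow (integral {a..b} (\<lambda>x. base (g x)))"
proof -
  let ?g = "\<lambda>x. base (g x)"
  have "((\<lambda>p. base (lf_sum g p)) \<longlongrightarrow> integral {a..b} ?g) (mesh_to_0 a b)"
  proof (rule tendstoI)
    fix e :: real assume "0 < e"
    \<comment> \<open>the factor 2 turns the weak bound of \<open>riemann_sum_error\<close> into a strict one\<close>
    define e' where "e' = e / (2 * (b - a))"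
    have "0 < e'" and e': "e' * (b - a) < e"
      using \<open>0 < e\<close> \<open>a < b\<close> by (auto simp: e'_def field_simps)
    have "uniformly_continuous_on {a..b} ?g"
      using g by (intro compact_uniformly_continuous) auto
    then obtain \<delta> where "0 < \<delta>"
      and \<delta>: "\<And>x y. x \<in> {a..b} \<Longrightarrow> y \<in> {a..b} \<Longrightarrow> \<bar>y - x\<bar> < \<delta> \<Longrightarrow> \<bar>?g y - ?g x\<bar> < e'"
      using \<open>0 < e'\<close> unfolding uniformly_continuous_on_def dist_real_def by metis
    have "dist (base (lf_sum g (N, t))) (integral {a..b} ?g) < e"
      if p: "(N, t) \<in> partitions a b" "mesh (N, t) < \<delta>" for N t
    proof -
      have "\<bar>(\<Sum>j<N. ?g (t j) * (t (Suc j) - t j)) - integral {a..b} ?g\<bar> \<le> e' * (b - a)"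
        using p g \<delta> by (intro riemann_sum_error) (auto intro: less_imp_le)
      with e' show ?thesis
        by (simp add: lf_sum_def base_sum base_simps dist_real_def)
    qed
    with \<open>0 < \<delta>\<close>
    show "\<forall>\<^sub>F p in mesh_to_0 a b. dist (base (lf_sum g p)) (integral {a..b} ?g) < e"
      by (auto simp: eventually_mesh_to_0)
  qed
  then have "(lf_sum g \<longlongrightarrow> fpow (integral {a..b} ?g)) (mesh_to_0 a b)"
    by (simp add: tendsto_areal_iff_base)
  then show ?thesis
    unfolding lf_int_def using mesh_to_0_neq_bot[OF \<open>a < b\<close>] by (rule tendsto_Lim[rotated])
qed

section \<open>The trapezoidal identity\<close>

text \<open>
  With \<open>x t = t a + (1 - t) b\<close>, which runs from \<open>b\<close> to \<open>a\<close> with derivative \<open>a - b\<close>, integrate the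
  derivative of \<open>(1 - 2 t) F (x t)\<close> over \<open>[0, 1]\<close>. The weight \<open>1 - 2 t\<close> is \<open>1\<close> at one end and
  \<open>-1\<close> at the other, so the boundary terms add up to \<open>- F a - F b\<close>; its derivative is constant, so
  the remaining term is a multiple of the mean of \<open>F\<close>.
\<close>

lemma trapezoid_error_identity:
  fixes F F' :: "real \<Rightarrow> real"
  assumes "a < b"
    and deriv: "\<And>x. x \<in> {a..b} \<Longrightarrow> (F has_real_derivative F' x) (at x)"
    and cont: "continuous_on {a..b} F'"
  shows "(F a + F b) / 2 - integral {a..b} F / (b - a)
    = (b - a) / 2 * integral {0..1} (\<lambda>t. (1 - 2 * t) * F' (t * a + (1 - t) * b))"
proof -
  define x where "x t = t * a + (1 - t) * b" for t
  have x_mem: "x t \<in> {a..b}" if "t \<in> {0..1}" for t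
    using convexD_alt[of "{a..b}" b a t] that \<open>a < b\<close> by (simp add: x_def add.commute)
  have x_deriv: "(x has_real_derivative a - b) (at t)" for t
    unfolding x_def by (auto intro!: derivative_eq_intros)
  have cont_F: "continuous_on {a..b} F"
    using deriv by (intro DERIV_continuous_on) (auto intro: has_field_derivative_at_within)
  have cont_x: "continuous_on {0..1} x"
    unfolding x_def by (intro continuous_intros)
  have cont_comp: "continuous_on {0..1} (\<lambda>t. g (x t))" if "continuous_on {a..b} g" for g :: "real \<Rightarrow> real"
    using continuous_on_compose2[OF that cont_x] x_mem by blast
  \<comment> \<open>The substitution \<open>x\<close>, which reverses orientation, is carried out by differentiating the
    indefinite integral of \<open>F\<close> along \<open>x\<close>.\<close>
  have FTC: "((\<lambda>t. (a - b) * F (x t)) has_integral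
      integral {a..x 1} F - integral {a..x 0} F) {0..1}"
  proof (rule fundamental_theorem_of_calculus)
    fix t :: real assume t: "t \<in> {0..1}"
    have "((\<lambda>u. integral {a..u} F) has_real_derivative F (x t)) (at (x t) within {a..b})"
      using x_mem[OF t] by (intro integral_has_real_derivative cont_F)
    then have "((\<lambda>u. integral {a..u} F) has_real_derivative F (x t)) (at (x t) within x ` {0..1})"
      using x_mem by (rule_tac DERIV_subset) auto
    from DERIV_image_chain[OF this has_field_derivative_at_within[OF x_deriv]]
    show "((\<lambda>t. integral {a..x t} F) has_vector_derivative (a - b) * F (x t)) (at t within {0..1})"
      by (simp add: o_def has_real_derivative_iff_has_vector_derivative mult.commute)
  qed simp
  have int_F: "(b - a) * integral {0..1} (\<lambda>t. F (x t)) = integral {a..b} F"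
  proof -
    have "(a - b) * integral {0..1} (\<lambda>t. F (x t)) = integral {a..x 1} F - integral {a..x 0} F"
      using integral_unique[OF FTC] by (simp only: integral_mult_right)
    then show ?thesis by (simp add: x_def left_diff_distrib)
  qed
  have "((\<lambda>t. (a - b) * ((1 - 2 * t) * F' (x t)) - 2 * F (x t)) has_integral
      (1 - 2 * 1) * F (x 1) - (1 - 2 * 0) * F (x 0)) {0..1}"
  proof (rule fundamental_theorem_of_calculus)
    fix t :: real assume t: "t \<in> {0..1}"
    have "((\<lambda>t. F (x t)) has_real_derivative F' (x t) * (a - b)) (at t)"
      using DERIV_chain[OF deriv[OF x_mem[OF t]] x_deriv] by (simp add: o_def)
    then have "((\<lambda>t. (1 - 2 * t) * F (x t)) has_real_derivative
        (a - b) * ((1 - 2 * t) * F' (x t)) - 2 * F (x t)) (at t)"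
      by (auto intro!: derivative_eq_intros simp: algebra_simps)
    then show "((\<lambda>t. (1 - 2 * t) * F (x t)) has_vector_derivative
        (a - b) * ((1 - 2 * t) * F' (x t)) - 2 * F (x t)) (at t within {0..1})"
      by (simp add: has_field_derivative_at_within flip: has_real_derivative_iff_has_vector_derivative)
  qed simp
  then have "integral {0..1} (\<lambda>t. (a - b) * ((1 - 2 * t) * F' (x t)) - 2 * F (x t)) = - F a - F b"
    by (simp add: integral_unique x_def)
  moreover have "integral {0..1} (\<lambda>t. (a - b) * ((1 - 2 * t) * F' (x t)) - 2 * F (x t))
    = (a - b) * integral {0..1} (\<lambda>t. (1 - 2 * t) * F' (x t)) - 2 * integral {0..1} (\<lambda>t. F (x t))"
    by (subst integral_diff)
      (auto intro!: integrable_continuous_interval continuous_intros cont_comp cont cont_F)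
  ultimately have "(b - a) * integral {0..1} (\<lambda>t. (1 - 2 * t) * F' (x t))
    = F a + F b - 2 * integral {0..1} (\<lambda>t. F (x t))"
    by (simp add: algebra_simps)
  moreover have "integral {0..1} (\<lambda>t. F (x t)) = integral {a..b} F / (b - a)"
    using int_F \<open>a < b\<close> by (simp add: field_simps)
  ultimately show ?thesis
    unfolding x_def by (simp add: field_simps)
qed

theorem theorem1:
  fixes \<alpha> :: real and I :: "real set" and f :: "real \<Rightarrow> areal" and a b :: real
  assumes "0 < \<alpha>" and "\<alpha> \<le> 1"
    and "is_interval I"
    and "f \<in> lf_D \<alpha> (interior I)"
    and "a \<in> interior I" and "b \<in> interior I" and "a < b"
    and "lf_deriv \<alpha> f \<in> lf_C {a..b}"
  shows "(f a + f b) / fpow 2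
           - of_number \<alpha> (Gamma (1 + \<alpha>)) / fpow (b - a) * lf_I \<alpha> a b f
         = fpow (b - a) / fpow 2
           * (1 / of_number \<alpha> (Gamma (1 + \<alpha>))
              * lf_int 0 1 (\<lambda>t. fpow (1 - 2 * t) * lf_deriv \<alpha> f (t * a + (1 - t) * b)))"
proof -
  define G where "G = base (of_number \<alpha> (Gamma (1 + \<alpha>)))"
  define F where "F x = base (f x)" for x
  define F' where "F' x = base (lf_deriv \<alpha> f x) / G" for x
  have "0 < G"
    unfolding G_def using \<open>0 < \<alpha>\<close> by (intro base_of_number_pos Gamma_real_pos) simp
  have "is_interval (interior I)"
    using \<open>is_interval I\<close> by (simp add: is_interval_convex_1 convex_interior)
  then have sub: "{a..b} \<subseteq> interior I"
    using mem_is_interval_1_I[OF _ assms(5,6)] by auto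
  have deriv: "(F has_real_derivative F' x) (at x)" if "x \<in> {a..b}" for x
  proof -
    have "x \<in> interior I"
      using sub that by (rule subsetD)
    then obtain D where "has_lf_deriv \<alpha> f D x"
      using assms(4) by (auto simp: lf_D_def)
    from has_lf_deriv_lf_deriv[OF this] show ?thesis
      using has_lf_deriv_iff_base[OF \<open>0 < \<alpha>\<close>] unfolding F_def F'_def G_def by simp
  qed
  have cont_F: "continuous_on {a..b} F"
    using deriv by (intro DERIV_continuous_on) (auto intro: has_field_derivative_at_within)
  have cont_D: "continuous_on {a..b} (\<lambda>x. base (lf_deriv \<alpha> f x))"
    using assms(8) by (simp add: lf_C_iff_continuous_on_base)
  then have cont_F': "continuous_on {a..b} F'"
    unfolding F'_def using \<open>0 < G\<close> by (intro continuous_intros) auto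
  have "continuous_on {0..1} (\<lambda>t. base (lf_deriv \<alpha> f (t * a + (1 - t) * b)))"
  proof (rule continuous_on_compose2[OF cont_D])
    show "(\<lambda>t. t * a + (1 - t) * b) ` {0..1} \<subseteq> {a..b}"
      using convexD_alt[of "{a..b}" b a] \<open>a < b\<close> by (auto simp: add.commute)
  qed (intro continuous_intros)
  then have "lf_int 0 1 (\<lambda>t. fpow (1 - 2 * t) * lf_deriv \<alpha> f (t * a + (1 - t) * b))
    = fpow (integral {0..1} (\<lambda>t. G * ((1 - 2 * t) * F' (t * a + (1 - t) * b))))"
    using \<open>0 < G\<close> by (subst lf_int_eq_integral) (auto simp: base_simps F'_def intro!: continuous_intros)
  moreover have "lf_int a b f = fpow (integral {a..b} F)"
    using \<open>a < b\<close> cont_F unfolding F_def by (rule lf_int_eq_integral)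
  ultimately show ?thesis
    using trapezoid_error_identity[OF \<open>a < b\<close> deriv cont_F'] \<open>0 < G\<close>
    by (simp add: base_inject[symmetric] lf_I_def base_simps flip: G_def F_def)
qed

end
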